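(* For every positive integer $n$ there is a tournament $G$ with more than $n^{8/7}/4$ vertices such that $f(G) \le n$. Consequently, $g(n) \ge n^{8/7}/4$.
   Context: All graphs are finite and simple. A tournament is an orientation of a complete graph. The chromatic number of an oriented graph is the chromatic number of its underlying undirected graph. An acyclic subgraph of an oriented graph is a subgraph containing no directed cycle. For an oriented graph $G$, $f(G)$ denotes the maximum chromatic number of an acyclic subgraph of $G$. For a positive integer $n$, $g(n)$ is the smallest integer such that every tournament $G$ with more than $g(n)$ vertices satisfies $f(G) > n$. *)

theory Defs
  imports Complex_Main "Graph_Theory.Graph_Theory"
begin

text \<open>
  A simple digraph is a \<^typ>\<open>'a pair_pre_digraph\<close> satisfying \<^const>\<open>pair_digraph\<close> (finite,
  loopless, arcs are pairs of vertices). Following the library, an undirected simple graph is a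
  symmetric digraph; the undirected graph underlying a digraph \<open>G\<close> is \<open>mk_symmetric G\<close>.
\<close>

definition oriented_graph :: "'a pair_pre_digraph \<Rightarrow> bool" where
  "oriented_graph G \<longleftrightarrow> pair_digraph G \<and> (\<forall>u v. (u, v) \<in> parcs G \<longrightarrow> (v, u) \<notin> parcs G)"

definition tournament :: "'a pair_pre_digraph \<Rightarrow> bool" where
  "tournament G \<longleftrightarrow> oriented_graph G \<and> (\<exists>m. complete_digraph m (mk_symmetric G))"

definition proper_colouring :: "'a pair_pre_digraph \<Rightarrow> nat \<Rightarrow> ('a \<Rightarrow> nat) \<Rightarrow> bool" where
  "proper_colouring G k c \<longleftrightarrow>
     c ` pverts G \<subseteq> {..<k} \<and> (\<forall>(u, v) \<in> parcs G. c u \<noteq> c v)"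

definition chromatic_number :: "'a pair_pre_digraph \<Rightarrow> nat" where
  "chromatic_number G = (LEAST k. \<exists>c. proper_colouring G k c)"

definition oriented_chromatic_number :: "'a pair_pre_digraph \<Rightarrow> nat" where
  "oriented_chromatic_number G = chromatic_number (mk_symmetric G)"

text \<open>
  The library's \<^const>\<open>pre_digraph.cycle\<close> is a directed cycle: a nonempty closed walk along the arcs
  without repeated vertices.
\<close>

definition acyclic_digraph :: "'a pair_pre_digraph \<Rightarrow> bool" where
  "acyclic_digraph G \<longleftrightarrow> \<not> (\<exists>p. pre_digraph.cycle (with_proj G) p)"

text \<open>For a finite oriented graph the set below is finite, and it contains the value of the null
  subgraph, so the maximum is attained.\<close>

definition max_acyclic_chromatic :: "'a pair_pre_digraph \<Rightarrow> nat" where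
  "max_acyclic_chromatic G =
     Max {oriented_chromatic_number H |H :: 'a pair_pre_digraph.
            subgraph (with_proj H) (with_proj G) \<and> acyclic_digraph H}"

text \<open>
  Every finite tournament is isomorphic to one whose vertices are natural numbers, so quantifying
  over \<^typ>\<open>nat pair_pre_digraph\<close> covers all tournaments. For positive \<open>n\<close> the least integer with the
  stated property is nonnegative (a single vertex violates the property otherwise), so it is a
  natural number.
\<close>

definition tournament_threshold :: "nat \<Rightarrow> nat" where
  "tournament_threshold n =
     (LEAST N. \<forall>G :: nat pair_pre_digraph.
        tournament G \<and> card (pverts G) > N \<longrightarrow> max_acyclic_chromatic G > n)"

end

theory Submission
  imports Defs
begin

text \<open>
  The vertices form an \<open>m \<times> m\<close> grid. A row arc points to the larger column, a column arc to the
  larger row, but if both coordinates grow the arc points backwards. An acyclic subgraph carries a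
  potential \<open>\<pi>\<close> increasing along its arcs, and a set is independent in it once \<open>\<pi>\<close> weakly decreases
  along the arcs of the tournament inside the set. Suppose no set of size \<open>l + 1\<close> has this property.
  Labelling vertices by chains along which \<open>\<pi>\<close> decreases in rows and in columns splits any set of
  vertices into \<open>l\<^sup>2\<close> classes, inside each of which \<open>\<pi>\<close> increases along rows and columns. A class
  with more than \<open>2 m l\<close> elements contains a staircase with \<open>l + 1\<close> steps, and \<open>\<pi>\<close> increases along
  it, so its corners are independent. Hence every set of more than \<open>2 m l\<^sup>3\<close> vertices contains an
  independent set of size \<open>l + 1\<close>, and removing such sets greedily colours the \<open>m\<^sup>2\<close> vertices with
  \<open>O(m powr (5/3))\<close> colours. This beats the exponent \<open>8/7\<close>, which leaves room for the constant.

  The threshold is the least element of a nonempty set because splitting a tournament into its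
  arcs ascending and descending in the order of the naturals gives two acyclic subgraphs whose
  chromatic numbers have a product at least the number of vertices.
\<close>

section \<open>Chain labellings and staircases\<close>

text \<open>Mirsky's argument: elements without an \<open>R\<close>-predecessor in \<open>U\<close>
  get the top label. A chain among the others can be prolonged by a predecessor of its first
  element, so its length bound drops by one. Lists may repeat entries, so the bound also rules out
  \<open>R v v\<close> on \<open>U\<close>.\<close>

lemma sorted_wrt_label:
  fixes R :: "'a \<Rightarrow> 'a \<Rightarrow> bool"
  assumes "transp R"
    and "\<And>xs. sorted_wrt R xs \<Longrightarrow> set xs \<subseteq> U \<Longrightarrow> length xs \<le> k"
  shows "\<exists>p. p ` U \<subseteq> {..<k} \<and> (\<forall>u\<in>U. \<forall>v\<in>U. R u v \<longrightarrow> p u \<noteq> p v)"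
  using assms(2)
proof (induction k arbitrary: U)
  case 0
  have "U = {}"
  proof (rule ccontr)
    assume "U \<noteq> {}"
    then obtain v where "v \<in> U" by blast
    then show False using 0[of "[v]"] by simp
  qed
  then show ?case by simp
next
  case (Suc k)
  define W where "W = {v \<in> U. \<exists>w\<in>U. R w v}"
  have "length xs \<le> k" if xs: "sorted_wrt R xs" "set xs \<subseteq> W" for xs
  proof (cases xs)
    case (Cons x ys)
    then obtain w where w: "w \<in> U" "R w x" using xs unfolding W_def by auto
    have "sorted_wrt R (w # xs)"
      using xs(1) w(2) Cons \<open>transp R\<close> by (auto dest: transpD)
    moreover have "set (w # xs) \<subseteq> U" using xs(2) w(1) by (auto simp: W_def)
    ultimately show ?thesis using Suc.prems by fastforce
  qed simp
  from Suc.IH[OF this] obtain p where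
    p: "p ` W \<subseteq> {..<k}" "\<forall>u\<in>W. \<forall>v\<in>W. R u v \<longrightarrow> p u \<noteq> p v" by blast
  define q where "q v = (if v \<in> W then p v else k)" for v
  have "q ` U \<subseteq> {..<Suc k}" using p(1) by (auto simp: q_def less_Suc_eq)
  moreover have "q u \<noteq> q v" if "u \<in> U" "v \<in> U" "R u v" for u v
  proof -
    have "v \<in> W" using that by (auto simp: W_def)
    then have "p v < k" using p(1) by auto
    then show ?thesis using p(2) \<open>v \<in> W\<close> that(3) by (auto simp: q_def)
  qed
  ultimately show ?case by blast
qed

text \<open>Peeling: deleting the vertex of least row in each column, and then the vertex of least
  column in each remaining row, costs at most \<open>2 * m\<close> vertices. A staircase in what is
  left can be extended by one step at its start. The corners \<open>w\<close> are kept inside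
  \<open>C\<close> because \<pi> will be compared along both legs of each step.\<close>

lemma staircase:
  fixes r c :: "'a \<Rightarrow> nat"
  assumes "finite C" and "r ` C \<subseteq> {..<m}" and "c ` C \<subseteq> {..<m}"
    and "inj_on (\<lambda>v. (r v, c v)) C"
    and "2 * m * l < card C"
  shows "\<exists>xs. set xs \<subseteq> C \<and> length xs = Suc l \<and>
    sorted_wrt (\<lambda>u v. r u < r v \<and> c u < c v) xs \<and>
    successively (\<lambda>u v. \<exists>w\<in>C. c u = c w \<and> r u < r w \<and> r w = r v \<and> c w < c v) xs"
  using assms
proof (induction l arbitrary: C)
  case 0
  then obtain v where "v \<in> C" by (metis card.empty all_not_in_conv less_nat_zero_code)
  then show ?case by (intro exI[of _ "[v]"]) simp
next
  case (Suc l)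
  note fin = \<open>finite C\<close>
  define D where "D = {w \<in> C. \<exists>u\<in>C. c u = c w \<and> r u < r w}"
  define E where "E = {v \<in> D. \<exists>w\<in>D. r w = r v \<and> c w < c v}"
  have sub: "E \<subseteq> D" "D \<subseteq> C" by (auto simp: D_def E_def)
  have "inj_on c (C - D)"
  proof (rule inj_onI, rule ccontr)
    fix x y assume xy: "x \<in> C - D" "y \<in> C - D" "c x = c y" "x \<noteq> y"
    then have "r x \<noteq> r y" using Suc.prems(4) by (auto simp: inj_on_def)
    then have "r x < r y \<or> r y < r x" by linarith
    then show False using xy by (auto simp: D_def)
  qed
  moreover have "c ` (C - D) \<subseteq> {..<m}" using Suc.prems(3) by blast
  ultimately have "card (C - D) \<le> m"
    using card_inj_on_le[of c "C - D" "{..<m}"] by simp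
  moreover have "inj_on r (D - E)"
  proof (rule inj_onI, rule ccontr)
    fix x y assume xy: "x \<in> D - E" "y \<in> D - E" "r x = r y" "x \<noteq> y"
    then have "c x \<noteq> c y" using Suc.prems(4) sub by (auto simp: inj_on_def)
    then have "c x < c y \<or> c y < c x" by linarith
    then show False using xy by (auto simp: E_def)
  qed
  moreover have "r ` (D - E) \<subseteq> {..<m}" using Suc.prems(2) sub by blast
  ultimately have "card (C - D) \<le> m" "card (D - E) \<le> m"
    using card_inj_on_le[of r "D - E" "{..<m}"] by simp_all
  moreover have "card C = card (C - D) + card (D - E) + card E"
  proof -
    have "finite D" using sub(2) fin by (rule finite_subset)
    moreover from sub(1) this have "finite E" by (rule finite_subset)
    ultimately show ?thesis
      using sub fin card_mono[of D E] card_mono[of C D] by (simp add: card_Diff_subset)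
  qed
  ultimately have "2 * m * l < card E" using Suc.prems(5) by simp
  moreover have "inj_on (\<lambda>v. (r v, c v)) E"
    using Suc.prems(4) by (rule inj_on_subset) (use sub in blast)
  ultimately obtain xs where xs: "set xs \<subseteq> E" "length xs = Suc l"
    "sorted_wrt (\<lambda>u v. r u < r v \<and> c u < c v) xs"
    "successively (\<lambda>u v. \<exists>w\<in>E. c u = c w \<and> r u < r w \<and> r w = r v \<and> c w < c v) xs"
  proof -
    have "E \<subseteq> C" using sub by blast
    then have "finite E" using fin by (rule finite_subset)
    moreover have "r ` E \<subseteq> {..<m}" "c ` E \<subseteq> {..<m}"
      using Suc.prems(2,3) \<open>E \<subseteq> C\<close> by blast+
    ultimately show ?thesis
      using Suc.IH[of E, OF _ _ _ \<open>inj_on (\<lambda>v. (r v, c v)) E\<close> \<open>2 * m * l < card E\<close>] that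
      by blast
  qed
  from xs(2) obtain x ys where [simp]: "xs = x # ys" by (cases xs) auto
  have "x \<in> E" using xs(1) by simp
  \<comment> \<open>Survival of \<open>x\<close> in both deletions provides a corner
    \<open>w\<close> in its row and a new first vertex \<open>u\<close> in the column of
    \<open>w\<close>.\<close>
  then obtain w where "w \<in> D" "r w = r x" "c w < c x" by (auto simp: E_def)
  moreover from this(1) obtain u where "u \<in> C" "c u = c w" "r u < r w" by (auto simp: D_def)
  ultimately obtain w u where wu: "w \<in> D" "r w = r x" "c w < c x" "u \<in> C" "c u = c w" "r u < r w" by blast
  have "sorted_wrt (\<lambda>u v. r u < r v \<and> c u < c v) (u # xs)"
    using xs(3) wu less_trans by auto
  moreover have "successively (\<lambda>u v. \<exists>w\<in>C. c u = c w \<and> r u < r w \<and> r w = r v \<and> c w < c v) xs"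
    by (rule successively_mono[OF xs(4)]) (use sub in blast)
  then have "successively (\<lambda>u v. \<exists>w\<in>C. c u = c w \<and> r u < r w \<and> r w = r v \<and> c w < c v) (u # xs)"
    using wu sub by auto
  moreover have "set (u # xs) \<subseteq> C" using xs(1) sub wu(4) by auto
  ultimately show ?case using xs(2) by (intro exI[of _ "u # xs"]) simp
qed

section \<open>Orientation of the grid and backward sets\<close>

definition dominates :: "('a \<Rightarrow> nat) \<Rightarrow> ('a \<Rightarrow> nat) \<Rightarrow> 'a \<Rightarrow> 'a \<Rightarrow> bool" where
  "dominates r c u v \<longleftrightarrow>
     r u < r v \<and> c v \<le> c u \<or> r u = r v \<and> c u < c v \<or> r v < r u \<and> c v < c u"

lemma dominates_total:
  assumes "r u \<noteq> r v \<or> c u \<noteq> c v"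
  shows "dominates r c u v \<or> dominates r c v u"
  using assms unfolding dominates_def by linarith

definition backward_set :: "('a \<Rightarrow> 'a \<Rightarrow> bool) \<Rightarrow> ('a \<Rightarrow> nat) \<Rightarrow> 'a set \<Rightarrow> bool" where
  "backward_set D \<pi> S \<longleftrightarrow> (\<forall>u\<in>S. \<forall>v\<in>S. D u v \<longrightarrow> \<pi> v \<le> \<pi> u)"

text \<open>One criterion for three kinds of chains: rows and columns along which \<pi> weakly
  decreases, and diagonals along which \<pi> increases. For the diagonals the arcs run against the
  order of the list.\<close>

lemma backward_set_sorted_wrt:
  assumes "sorted_wrt R xs"
    and "\<And>u. \<not> D u u"
    and "\<And>u v. R u v \<Longrightarrow> (D u v \<longrightarrow> \<pi> v \<le> \<pi> u) \<and> (D v u \<longrightarrow> \<pi> u \<le> \<pi> v)"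
  shows "backward_set D \<pi> (set xs)"
  using assms(1)
proof (induction xs)
  case (Cons x xs)
  then show ?case using assms(2,3) by (auto simp: backward_set_def)
qed (simp add: backward_set_def)

lemma card_sorted_wrt:
  assumes "sorted_wrt R xs" and "\<And>u. \<not> R u u"
  shows "card (set xs) = length xs"
  using assms(1)
proof (induction xs)
  case (Cons x xs)
  then show ?case using assms(2) by (auto simp: card_insert_if)
qed simp

lemma large_backward_set:
  fixes r c \<pi> :: "'a \<Rightarrow> nat"
  assumes fin: "finite U" and rU: "r ` U \<subseteq> {..<m}" and cU: "c ` U \<subseteq> {..<m}"
    and inj: "inj_on (\<lambda>v. (r v, c v)) U"
    and large: "2 * m * l ^ 3 < card U"
  shows "\<exists>S\<subseteq>U. Suc l \<le> card S \<and> backward_set (dominates r c) \<pi> S"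
proof (rule ccontr)
  assume neg: "\<not> ?thesis"
  have short: "length xs \<le> l"
    if "sorted_wrt R xs" "set xs \<subseteq> U" "\<And>u. \<not> R u u"
      "\<And>u v. R u v \<Longrightarrow> (dominates r c u v \<longrightarrow> \<pi> v \<le> \<pi> u) \<and> (dominates r c v u \<longrightarrow> \<pi> u \<le> \<pi> v)"
    for R xs
  proof -
    have "backward_set (dominates r c) \<pi> (set xs)"
      by (rule backward_set_sorted_wrt[OF that(1) _ that(4)]) (auto simp: dominates_def)
    then have "\<not> Suc l \<le> card (set xs)" using neg that(2) by blast
    then show ?thesis using card_sorted_wrt[OF that(1,3)] by simp
  qed
  \<comment> \<open>The inequality on \<pi> is weak, so that vertices with equal labels in a common
    row or column have strictly increasing \<pi>.\<close>
  let ?R = "\<lambda>u v. r u = r v \<and> c u < c v \<and> \<pi> v \<le> \<pi> u"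
  let ?C = "\<lambda>u v. c u = c v \<and> r u < r v \<and> \<pi> v \<le> \<pi> u"
  have "length xs \<le> l" if "sorted_wrt ?R xs" "set xs \<subseteq> U" for xs
    by (rule short[OF that]) (auto simp: dominates_def)
  moreover have "transp ?R" by (rule transpI) auto
  ultimately obtain p where p: "p ` U \<subseteq> {..<l}" "\<forall>u\<in>U. \<forall>v\<in>U. ?R u v \<longrightarrow> p u \<noteq> p v"
    using sorted_wrt_label[of ?R U l] by blast
  have "length xs \<le> l" if "sorted_wrt ?C xs" "set xs \<subseteq> U" for xs
    by (rule short[OF that]) (auto simp: dominates_def)
  moreover have "transp ?C" by (rule transpI) auto
  ultimately obtain q where q: "q ` U \<subseteq> {..<l}" "\<forall>u\<in>U. \<forall>v\<in>U. ?C u v \<longrightarrow> q u \<noteq> q v"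
    using sorted_wrt_label[of ?C U l] by blast
  define B where "B ab = {v \<in> U. (p v, q v) = ab}" for ab
  have "\<exists>ab\<in>{..<l} \<times> {..<l}. 2 * m * l < card (B ab)"
  proof (rule ccontr)
    assume "\<not> ?thesis"
    then have le: "card (B ab) \<le> 2 * m * l" if "ab \<in> {..<l} \<times> {..<l}" for ab
      using that by (meson not_le)
    have "U = (\<Union>ab\<in>{..<l} \<times> {..<l}. B ab)" using p(1) q(1) by (auto simp: B_def image_subset_iff)
    then have "card U \<le> (\<Sum>ab\<in>{..<l} \<times> {..<l}. card (B ab))"
      using card_UN_le[of "{..<l} \<times> {..<l}" B] by simp
    also have "\<dots> \<le> (\<Sum>ab\<in>{..<l} \<times> {..<l}. 2 * m * l)" by (rule sum_mono) (rule le)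
    also have "\<dots> = 2 * m * l ^ 3" by (simp add: power3_eq_cube)
    finally show False using large by simp
  qed
  then obtain ab where big: "2 * m * l < card (B ab)" by blast
  have BU: "B ab \<subseteq> U" by (auto simp: B_def)
  obtain xs where xs: "set xs \<subseteq> B ab" "length xs = Suc l"
    "successively (\<lambda>u v. \<exists>w\<in>B ab. c u = c w \<and> r u < r w \<and> r w = r v \<and> c w < c v) xs"
  proof -
    have "finite (B ab)" using BU fin by (rule finite_subset)
    moreover have "r ` B ab \<subseteq> {..<m}" "c ` B ab \<subseteq> {..<m}" using rU cU BU by blast+
    moreover have "inj_on (\<lambda>v. (r v, c v)) (B ab)" using inj BU by (rule inj_on_subset)
    ultimately show ?thesis using staircase[OF _ _ _ _ big, of r c] that by blast
  qed
  \<comment> \<open>The corner gives \<pi> u < \<pi> w < \<pi> v, one inequality from each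
    labelling. Transitivity then passes from consecutive vertices to all pairs.\<close>
  let ?D = "\<lambda>u v. r u < r v \<and> c u < c v \<and> \<pi> u < \<pi> v"
  have "successively ?D xs"
  proof (rule successively_mono[OF xs(3)])
    fix u v assume uv: "u \<in> set xs" "v \<in> set xs"
      and "\<exists>w\<in>B ab. c u = c w \<and> r u < r w \<and> r w = r v \<and> c w < c v"
    then obtain w where w: "w \<in> B ab" "c u = c w" "r u < r w" "r w = r v" "c w < c v" by blast
    have B: "u \<in> B ab" "v \<in> B ab" using uv xs(1) by auto
    have U: "u \<in> U" "v \<in> U" "w \<in> U" and pq: "p w = p v" "q u = q w"
      using B w(1) by (auto simp: B_def)
    have "\<not> \<pi> w \<le> \<pi> u" using q(2) U pq(2) w(2,3) by blast
    moreover have "\<not> \<pi> v \<le> \<pi> w" using p(2) U pq(1) w(4,5) by blast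
    ultimately show "?D u v" using w by simp
  qed
  moreover have "transp ?D" by (rule transpI) auto
  ultimately have "sorted_wrt ?D xs" by (simp add: successively_conv_sorted_wrt)
  then have "length xs \<le> l"
    by (rule short) (use xs(1) BU in \<open>auto simp: dominates_def\<close>)
  then show False using xs(2) by simp
qed

section \<open>Greedy partition into large sets\<close>

text \<open>While \<open>u\<close> vertices remain, a set of at least \<open>root 3 (u / M)\<close>
  of them can be removed. The bound is the integral of \<open>root 3 (M / t)\<close> over
  \<open>t\<close> from 0 to \<open>card U\<close>.\<close>

lemma greedy_partition_real:
  fixes M :: nat
  assumes "finite U" and "M > 0"
    and large: "\<And>W l. W \<subseteq> U \<Longrightarrow> M * l ^ 3 < card W \<Longrightarrow> \<exists>S\<subseteq>W. Suc l \<le> card S \<and> P S"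
  shows "\<exists>p k. p ` U \<subseteq> {..<k} \<and> (\<forall>i<k. P {v \<in> U. p v = i}) \<and>
    real k \<le> 3 / 2 * root 3 (real M) * (root 3 (real (card U)))\<^sup>2"
  using assms(1,3)
proof (induction "card U" arbitrary: U rule: less_induct)
  case less
  show ?case
  proof (cases "U = {}")
    case True
    then show ?thesis by (intro exI[of _ "\<lambda>_. 0"] exI[of _ 0]) simp
  next
    case False
    let ?u = "card U"
    have "?u > 0" using False less.prems(1) by (simp add: card_gt_0_iff)
    have "?u \<le> ?u ^ 3" using \<open>?u > 0\<close> by (intro self_le_power) simp_all
    also have "\<dots> \<le> M * ?u ^ 3" using \<open>M > 0\<close> by simp
    finally have ex: "?u \<le> M * ?u ^ 3" .
    \<comment> \<open>Minimality gives \<open>M * l ^ 3 < ?u\<close> for \<open>l = k - 1\<close>,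
      so a set of size \<open>k\<close> exists, and \<open>k\<close> is at least the cube root of
      \<open>?u / M\<close>: rounding loses nothing.\<close>
    define k where "k = (LEAST k. ?u \<le> M * k ^ 3)"
    have k: "?u \<le> M * k ^ 3" "\<And>j. j < k \<Longrightarrow> M * j ^ 3 < ?u"
      using LeastI[of "\<lambda>k. ?u \<le> M * k ^ 3", OF ex] not_less_Least[of _ "\<lambda>k. ?u \<le> M * k ^ 3"]
      by (simp_all add: k_def not_le)
    have "k \<noteq> 0" using k(1) \<open>?u > 0\<close> by (intro notI) simp
    then obtain l where l: "k = Suc l" using not0_implies_Suc by blast
    obtain S where S: "S \<subseteq> U" "k \<le> card S" "P S"
      using less.prems(2)[of U l] k(2)[of l] l by auto
    have cS: "card (U - S) = ?u - card S" "card S \<le> ?u"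
      using S(1) less.prems(1) by (simp_all add: card_Diff_subset finite_subset card_mono)
    have "card (U - S) < ?u" using cS S(2) l \<open>?u > 0\<close> by linarith
    moreover have "finite (U - S)" using less.prems(1) by simp
    moreover have "\<exists>S\<subseteq>W. Suc l \<le> card S \<and> P S" if "W \<subseteq> U - S" "M * l ^ 3 < card W" for W l
      using less.prems(2)[of W l] that by blast
    ultimately obtain p j where
      p: "p ` (U - S) \<subseteq> {..<j}" "\<forall>i<j. P {v \<in> U - S. p v = i}"
        "real j \<le> 3 / 2 * root 3 (real M) * (root 3 (real (card (U - S))))\<^sup>2"
      using less.hyps[of "U - S"] by blast
    define q where "q v = (if v \<in> S then j else p v)" for v
    have "q ` U \<subseteq> {..<Suc j}" using p(1) by (auto simp: q_def less_Suc_eq)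
    moreover have "P {v \<in> U. q v = i}" if "i < Suc j" for i
    proof (cases "i = j")
      case True
      have "{v \<in> U. q v = i} = S" using S(1) p(1) True by (auto simp: q_def)
      then show ?thesis using S(3) by simp
    next
      case False
      then have "{v \<in> U. q v = i} = {v \<in> U - S. p v = i}" by (auto simp: q_def)
      then show ?thesis using p(2) that False by simp
    qed
    moreover have "real (Suc j) \<le> 3 / 2 * root 3 (real M) * (root 3 (real ?u))\<^sup>2"
    proof -
      \<comment> \<open>Goal: the bound drops by at least 1 when \<open>S\<close> is removed, that
        is, \<open>2 \<le> 3 * a * (x\<^sup>2 - y\<^sup>2)\<close>. This pays for the one new colour
        \<open>j\<close>.\<close>
      define x y a where "x = root 3 (real ?u)" and "y = root 3 (real (card (U - S)))"
        and "a = root 3 (real M)"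
      have nn: "x > 0" "y \<ge> 0" "a > 0"
        using \<open>?u > 0\<close> \<open>M > 0\<close> by (simp_all add: x_def y_def a_def)
      have cubes: "x ^ 3 = ?u" "y ^ 3 = card (U - S)" "a ^ 3 = M"
        by (simp_all add: x_def y_def a_def)
      have "x ^ 3 \<le> (a * k) ^ 3"
        using k(1) by (simp add: cubes power_mult_distrib flip: of_nat_mult of_nat_power)
      then have "x \<le> a * k" using nn by (simp add: power_mono_iff)
      also have "\<dots> \<le> a * (x ^ 3 - y ^ 3)"
        using nn S(2) cS by (simp add: cubes)
      finally have 1: "x \<le> a * (x ^ 3 - y ^ 3)" .
      \<comment> \<open>concavity of \<open>u \<mapsto> u powr (2 / 3)\<close>, in terms of cube roots\<close>
      have "2 * (x ^ 3 - y ^ 3) \<le> 3 * x * (x\<^sup>2 - y\<^sup>2)"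
      proof -
        have "0 \<le> (x - y)\<^sup>2 * (x + 2 * y)" using nn by simp
        also have "\<dots> = 3 * x * (x\<^sup>2 - y\<^sup>2) - 2 * (x ^ 3 - y ^ 3)"
          by (simp add: algebra_simps power2_eq_square power3_eq_cube)
        finally show ?thesis by simp
      qed
      then have "a * (2 * (x ^ 3 - y ^ 3)) \<le> a * (3 * x * (x\<^sup>2 - y\<^sup>2))"
        using nn(3) by simp
      with 1 have "x * 2 \<le> x * (3 * a * (x\<^sup>2 - y\<^sup>2))" by (simp add: algebra_simps)
      then have "2 \<le> 3 * a * (x\<^sup>2 - y\<^sup>2)" using nn(1) by simp
      moreover have "real j \<le> 3 / 2 * a * y\<^sup>2" using p(3) by (simp add: a_def y_def)
      ultimately have "real (Suc j) \<le> 3 / 2 * a * x\<^sup>2" by (simp add: algebra_simps)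
      then show ?thesis by (simp add: a_def x_def)
    qed
    ultimately show ?thesis by blast
  qed
qed

text \<open>Cubing removes the roots and leaves an inequality between naturals.\<close>

lemma greedy_partition:
  fixes M :: nat
  assumes "finite U" and "M > 0"
    and "\<And>W l. W \<subseteq> U \<Longrightarrow> M * l ^ 3 < card W \<Longrightarrow> \<exists>S\<subseteq>W. Suc l \<le> card S \<and> P S"
  obtains p k where "p ` U \<subseteq> {..<k}" "\<And>i. i < k \<Longrightarrow> P {v \<in> U. p v = i}"
    "8 * k ^ 3 \<le> 27 * M * (card U)\<^sup>2"
proof -
  obtain p k where pk: "p ` U \<subseteq> {..<k}" "\<forall>i<k. P {v \<in> U. p v = i}"
    "real k \<le> 3 / 2 * root 3 (real M) * (root 3 (real (card U)))\<^sup>2"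
    using greedy_partition_real[OF assms] by blast
  have "real k ^ 3 \<le> (3 / 2 * root 3 (real M) * (root 3 (real (card U)))\<^sup>2) ^ 3"
    using pk(3) by (rule power_mono) simp
  also have "\<dots> = 27 / 8 * (root 3 (real M)) ^ 3 * ((root 3 (real (card U))) ^ 3)\<^sup>2"
    by (simp add: power2_eq_square power3_eq_cube)
  also have "\<dots> = 27 / 8 * real M * (real (card U))\<^sup>2" by simp
  finally have "real (8 * k ^ 3) \<le> real (27 * M * (card U)\<^sup>2)" by simp
  then have "8 * k ^ 3 \<le> 27 * M * (card U)\<^sup>2" by (simp only: of_nat_le_iff)
  with pk that show ?thesis by blast
qed

section \<open>Potentials and chromatic numbers of acyclic subgraphs\<close>

lemma trancl_imp_cycle:
  assumes "pair_wf_digraph H" and "(v, v) \<in> (parcs H)\<^sup>+"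
  shows "\<not> acyclic_digraph H"
proof -
  interpret pair_wf_digraph H by fact
  from assms(2) obtain p where "awalk v p v" "p \<noteq> []"
    by (auto simp: reachable1_awalk)
  then have "closed_w p" by (auto simp: closed_w_def)
  then show ?thesis using closed_w_imp_cycle by (auto simp: acyclic_digraph_def)
qed

text \<open>The potential counts proper ancestors. Along an arc from \<open>u\<close> to
  \<open>v\<close> the ancestors of \<open>u\<close> are kept and \<open>u\<close> itself is added,
  which by acyclicity is not its own ancestor.\<close>

lemma acyclic_digraph_potential:
  assumes "pair_wf_digraph H" and "finite (pverts H)" and "acyclic_digraph H"
  obtains \<pi> :: "'a \<Rightarrow> nat" where "\<And>u v. (u, v) \<in> parcs H \<Longrightarrow> \<pi> u < \<pi> v"
proof
  fix u v assume uv: "(u, v) \<in> parcs H"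
  interpret pair_wf_digraph H by fact
  let ?A = "\<lambda>v. {w. (w, v) \<in> (parcs H)\<^sup>+}"
  have "?A v \<subseteq> pverts H" for v
    by (auto dest!: tranclD dest: in_arcsD1)
  then have "finite (?A v)" using assms(2) finite_subset by blast
  moreover have "?A u \<subset> ?A v"
    using uv trancl_imp_cycle[OF assms(1), of u] assms(3) by (auto intro: trancl_into_trancl)
  ultimately show "card (?A u) < card (?A v)" by (rule psubset_card_mono)
qed

text \<open>The order is left general because both natural and negated integer potentials occur
  below.\<close>

lemma acyclic_digraphI:
  fixes \<pi> :: "'a \<Rightarrow> 'b::order"
  assumes "pair_wf_digraph H" and mono: "\<And>u v. (u, v) \<in> parcs H \<Longrightarrow> \<pi> u < \<pi> v"
  shows "acyclic_digraph H"
proof -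
  interpret pair_wf_digraph H by fact
  have "\<pi> u < \<pi> v" if "(u, v) \<in> (parcs H)\<^sup>+" for u v
    using that by (induction rule: trancl_induct) (auto dest: mono intro: less_trans)
  moreover have "(u, u) \<in> (parcs H)\<^sup>+" if "awalk u p u" "p \<noteq> []" for u p
    using that reachable1_awalkI by auto
  ultimately show ?thesis unfolding acyclic_digraph_def cycle_def by blast
qed

lemma oriented_chromatic_number_le:
  assumes "c ` pverts H \<subseteq> {..<k}" and "\<And>u v. (u, v) \<in> parcs H \<Longrightarrow> c u \<noteq> c v"
  shows "oriented_chromatic_number H \<le> k"
proof -
  have "proper_colouring (mk_symmetric (with_proj H)) k c"
    using assms by (fastforce simp: proper_colouring_def parcs_mk_symmetric)
  then show ?thesis
    unfolding oriented_chromatic_number_def chromatic_number_def by (auto intro: Least_le)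
qed

text \<open>The \<open>LEAST\<close> in the chromatic number is attained because an injective
  numbering of the vertices is a proper colouring.\<close>

lemma oriented_colouring_exists:
  assumes "pair_wf_digraph H" and "finite (pverts H)" and "\<And>u. (u, u) \<notin> parcs H"
  obtains c where "c ` pverts H \<subseteq> {..<oriented_chromatic_number H}"
    "\<And>u v. (u, v) \<in> parcs H \<Longrightarrow> c u \<noteq> c v"
proof -
  interpret pair_wf_digraph H by fact
  obtain f :: "'a \<Rightarrow> nat" and k where f: "f ` pverts H = {i. i < k}" "inj_on f (pverts H)"
    using finite_imp_inj_to_nat_seg[OF assms(2)] by blast
  have ne: "f u \<noteq> f v" if "(u, v) \<in> parcs H" for u v
  proof
    assume "f u = f v"
    then have "u = v" using f(2) in_arcsD1[OF that] in_arcsD2[OF that] by (simp add: inj_on_eq_iff)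
    then show False using that assms(3)[of v] by simp
  qed
  have "proper_colouring (mk_symmetric (with_proj H)) k f"
    unfolding proper_colouring_def
  proof (intro conjI ballI)
    show "f ` pverts (mk_symmetric (with_proj H)) \<subseteq> {..<k}" using f(1) by (simp add: lessThan_def)
    fix e assume "e \<in> parcs (mk_symmetric (with_proj H))"
    then show "case e of (u, v) \<Rightarrow> f u \<noteq> f v" using ne ne[symmetric] by (auto simp: parcs_mk_symmetric)
  qed
  then have "\<exists>c. proper_colouring (mk_symmetric (with_proj H)) (oriented_chromatic_number H) c"
    unfolding oriented_chromatic_number_def chromatic_number_def
    by (intro LeastI[of "\<lambda>k. \<exists>c. proper_colouring (mk_symmetric (with_proj H)) k c"] exI)
  then obtain c where "proper_colouring (mk_symmetric (with_proj H)) (oriented_chromatic_number H) c" ..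
  then have "c ` pverts H \<subseteq> {..<oriented_chromatic_number H}"
    "\<forall>(u, v) \<in> parcs (mk_symmetric (with_proj H)). c u \<noteq> c v"
    by (simp_all add: proper_colouring_def)
  moreover from this(2) have "c u \<noteq> c v" if "(u, v) \<in> parcs H" for u v
    using that by (fastforce simp: parcs_mk_symmetric)
  ultimately show ?thesis using that by blast
qed

lemma subgraph_with_proj_iff:
  "subgraph (with_proj H) (with_proj G) \<longleftrightarrow>
     pverts H \<subseteq> pverts G \<and> parcs H \<subseteq> parcs G \<and> pair_wf_digraph G \<and> pair_wf_digraph H"
  by (simp add: subgraph_def compatible_def wf_digraph_wp_iff)

text \<open>A subgraph is determined by its vertex and arc sets, so there are finitely many. This
  gives \<open>Max\<close> its meaning.\<close>

lemma finite_acyclic_chromatic_numbers: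
  assumes "pair_fin_digraph G"
  shows "finite {oriented_chromatic_number H |H :: 'a pair_pre_digraph.
    subgraph (with_proj H) (with_proj G) \<and> acyclic_digraph H}"
proof -
  interpret pair_fin_digraph G by fact
  have "{oriented_chromatic_number H |H. subgraph (with_proj H) (with_proj G) \<and> acyclic_digraph H}
    \<subseteq> (\<lambda>(V, A). oriented_chromatic_number \<lparr>pverts = V, parcs = A\<rparr>) `
      (Pow (pverts G) \<times> Pow (parcs G))"
  proof (clarify)
    fix H :: "'a pair_pre_digraph" assume "subgraph (with_proj H) (with_proj G)"
    then show "oriented_chromatic_number H \<in> (\<lambda>(V, A). oriented_chromatic_number \<lparr>pverts = V, parcs = A\<rparr>) `
      (Pow (pverts G) \<times> Pow (parcs G))"
      by (cases H, intro image_eqI[of _ _ "(pverts H, parcs H)"]) (auto simp: subgraph_with_proj_iff)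
  qed
  then show ?thesis
    by (rule finite_subset) (simp add: pair_finite_verts pair_finite_arcs)
qed

lemma max_acyclic_chromatic_leI:
  assumes "pair_fin_digraph G"
    and "\<And>H. subgraph (with_proj H) (with_proj G) \<Longrightarrow> acyclic_digraph H \<Longrightarrow>
      oriented_chromatic_number H \<le> n"
  shows "max_acyclic_chromatic G \<le> n"
proof -
  interpret pair_fin_digraph G by fact
  \<comment> \<open>The null subgraph shows that the set under \<open>Max\<close> is
    nonempty.\<close>
  let ?N = "\<lparr>pverts = {}, parcs = {}\<rparr> :: 'a pair_pre_digraph"
  have wf: "pair_wf_digraph ?N" by unfold_locales simp_all
  then have "subgraph (with_proj ?N) (with_proj G)" "acyclic_digraph ?N"
    using acyclic_digraphI[OF wf, of "\<lambda>_. 0 :: nat"]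
    by (simp_all add: subgraph_with_proj_iff pair_wf_digraph_axioms)
  then show ?thesis
    unfolding max_acyclic_chromatic_def
    using finite_acyclic_chromatic_numbers[OF assms(1)] assms(2)
    by (subst Max_le_iff) auto
qed

lemma max_acyclic_chromatic_geI:
  assumes "pair_fin_digraph G"
    and "subgraph (with_proj H) (with_proj G)" and "acyclic_digraph H"
  shows "oriented_chromatic_number H \<le> max_acyclic_chromatic G"
  unfolding max_acyclic_chromatic_def
  using finite_acyclic_chromatic_numbers[OF assms(1)] assms(2,3) by (intro Max_ge) auto

text \<open>Trades completeness of the symmetric closure for a condition on pairs of vertices, the
  form used from here on.\<close>

lemma tournament_iff:
  "tournament G \<longleftrightarrow> pair_fin_digraph G \<and> (\<forall>u v. (u, v) \<in> parcs G \<longrightarrow> (v, u) \<notin> parcs G) \<and>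
     (\<forall>u\<in>pverts G. \<forall>v\<in>pverts G. u \<noteq> v \<longrightarrow> (u, v) \<in> parcs G \<or> (v, u) \<in> parcs G)"
proof (intro iffI conjI)
  assume "tournament G"
  then have pd: "pair_digraph G" and orient: "\<forall>u v. (u, v) \<in> parcs G \<longrightarrow> (v, u) \<notin> parcs G"
    and complete: "\<exists>m. complete_digraph m (with_proj (mk_symmetric (with_proj G)))"
    by (auto simp: tournament_def oriented_graph_def)
  show "pair_fin_digraph G" using pd by (simp add: pair_digraph_def)
  show "\<forall>u v. (u, v) \<in> parcs G \<longrightarrow> (v, u) \<notin> parcs G" by fact
  show "\<forall>u\<in>pverts G. \<forall>v\<in>pverts G. u \<noteq> v \<longrightarrow> (u, v) \<in> parcs G \<or> (v, u) \<in> parcs G"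
  proof (intro ballI impI)
    fix u v assume "u \<in> pverts G" "v \<in> pverts G" "u \<noteq> v"
    then have "(u, v) \<in> parcs (mk_symmetric (with_proj G))"
      using complete by (auto simp: complete_digraph_pair_def)
    then show "(u, v) \<in> parcs G \<or> (v, u) \<in> parcs G" by (auto simp: parcs_mk_symmetric)
  qed
next
  assume A: "pair_fin_digraph G \<and> (\<forall>u v. (u, v) \<in> parcs G \<longrightarrow> (v, u) \<notin> parcs G) \<and>
     (\<forall>u\<in>pverts G. \<forall>v\<in>pverts G. u \<noteq> v \<longrightarrow> (u, v) \<in> parcs G \<or> (v, u) \<in> parcs G)"
  then interpret pair_fin_digraph G by simp
  have irrefl: "(u, u) \<notin> parcs G" for u using A by blast
  then have pd: "pair_digraph G" by unfold_locales (metis prod.collapse)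
  have "parcs (mk_symmetric (with_proj G)) = {(u, v). (u, v) \<in> pverts G \<times> pverts G \<and> u \<noteq> v}"
  proof -
    have "parcs G \<subseteq> {(u, v). (u, v) \<in> pverts G \<times> pverts G \<and> u \<noteq> v}"
      using in_arcsD1 in_arcsD2 irrefl by auto
    moreover have "parcs (mk_symmetric (with_proj G)) = parcs G \<union> (parcs G)\<inverse>"
      by (auto simp: parcs_mk_symmetric)
    ultimately show ?thesis using A by auto
  qed
  then have "complete_digraph (card (pverts G)) (with_proj (mk_symmetric (with_proj G)))"
    using pair_finite_verts unfolding complete_digraph_pair_def by simp
  then show "tournament G" using A pd by (auto simp: tournament_def oriented_graph_def)
qed

section \<open>Existence of the threshold\<close>

lemma card_le_max_acyclic_chromatic_sq:
  fixes G :: "nat pair_pre_digraph"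
  assumes "tournament G"
  shows "card (pverts G) \<le> (max_acyclic_chromatic G)\<^sup>2"
proof -
  from assms interpret pair_fin_digraph G by (simp add: tournament_iff)
  define A where "A = \<lparr>pverts = pverts G, parcs = {(u, v) \<in> parcs G. u < v}\<rparr>"
  define B where "B = \<lparr>pverts = pverts G, parcs = {(u, v) \<in> parcs G. v < u}\<rparr>"
  let ?f = "max_acyclic_chromatic G"
  have wf: "pair_wf_digraph A" "pair_wf_digraph B"
    by (unfold_locales; auto simp: A_def B_def dest: in_arcsD1 in_arcsD2)+
  have "acyclic_digraph A" by (rule acyclic_digraphI[OF wf(1), of id]) (simp add: A_def)
  moreover have "acyclic_digraph B"
    by (rule acyclic_digraphI[OF wf(2), of "\<lambda>v. - int v"]) (simp add: B_def)
  ultimately have le: "oriented_chromatic_number A \<le> ?f" "oriented_chromatic_number B \<le> ?f"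
    by (auto intro!: max_acyclic_chromatic_geI pair_fin_digraph_axioms
        simp: subgraph_with_proj_iff wf pair_wf_digraph_axioms)
      (auto simp: A_def B_def)
  obtain a where a: "a ` pverts A \<subseteq> {..<oriented_chromatic_number A}"
    "\<And>u v. (u, v) \<in> parcs A \<Longrightarrow> a u \<noteq> a v"
    using oriented_colouring_exists[OF wf(1)] pair_finite_verts by (auto simp: A_def)
  obtain b where b: "b ` pverts B \<subseteq> {..<oriented_chromatic_number B}"
    "\<And>u v. (u, v) \<in> parcs B \<Longrightarrow> b u \<noteq> b v"
    using oriented_colouring_exists[OF wf(2)] pair_finite_verts by (auto simp: B_def)
  \<comment> \<open>Any two vertices are joined by an arc of \<open>A\<close> or of
    \<open>B\<close>, so one of the two colourings separates them.\<close>
  have "inj_on (\<lambda>v. (a v, b v)) (pverts G)"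
  proof (rule inj_onI, rule ccontr)
    fix u v assume uv: "u \<in> pverts G" "v \<in> pverts G" "(a u, b u) = (a v, b v)" "u \<noteq> v"
    then consider "(u, v) \<in> parcs G" | "(v, u) \<in> parcs G" using assms by (auto simp: tournament_iff)
    then show False
      using uv(3,4) a(2)[of u v] a(2)[of v u] b(2)[of u v] b(2)[of v u]
      by cases (cases "u < v"; auto simp: A_def B_def)+
  qed
  moreover have "(\<lambda>v. (a v, b v)) ` pverts G \<subseteq> {..<?f} \<times> {..<?f}"
    using a(1) b(1) le by (fastforce simp: A_def B_def)
  ultimately have "card (pverts G) \<le> card ({..<?f} \<times> {..<?f})"
    by (intro card_inj_on_le) auto
  then show ?thesis by (simp add: power2_eq_square)
qed

lemma card_le_tournament_threshold:
  fixes G :: "nat pair_pre_digraph"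
  assumes "tournament G" and "max_acyclic_chromatic G \<le> n"
  shows "card (pverts G) \<le> tournament_threshold n"
proof -
  let ?P = "\<lambda>N. \<forall>G :: nat pair_pre_digraph.
    tournament G \<and> card (pverts G) > N \<longrightarrow> max_acyclic_chromatic G > n"
  \<comment> \<open>\<open>LEAST\<close> needs some witness: more than \<open>n\<^sup>2\<close>
    vertices force the square of the maximum above \<open>n\<^sup>2\<close>.\<close>
  have "?P (n\<^sup>2)"
    using card_le_max_acyclic_chromatic_sq
    by (meson less_le_trans not_le power2_nat_le_imp_le power2_less_imp_less zero_le)
  then have "?P (tournament_threshold n)"
    unfolding tournament_threshold_def by (rule LeastI)
  then show ?thesis using assms by (meson not_le)
qed

section \<open>The grid tournament\<close>

text \<open>Cells are numbered row by row in a grid with \<open>m\<close> columns, and the first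
  \<open>N\<close> are taken. The square case is \<open>N = m\<^sup>2\<close>; \<open>m = 1\<close>
  serves for small \<open>n\<close>.\<close>

definition grid_tournament :: "nat \<Rightarrow> nat \<Rightarrow> nat pair_pre_digraph" where
  "grid_tournament m N = \<lparr>pverts = {..<N},
     parcs = {(u, v). u < N \<and> v < N \<and> dominates (\<lambda>x. x div m) (\<lambda>x. x mod m) u v}\<rparr>"

lemma tournament_grid_tournament: "tournament (grid_tournament m N)"
proof -
  \<comment> \<open>This also holds for \<open>m = 0\<close>, where \<open>u div 0 = 0\<close> and
    \<open>u mod 0 = u\<close>.\<close>
  have eq: "u = v" if "u div m = v div m" "u mod m = v mod m" for u v
    using that by (metis div_mult_mod_eq)
  have "parcs (grid_tournament m N) \<subseteq> {..<N} \<times> {..<N}"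
    by (auto simp: grid_tournament_def)
  then have "finite (parcs (grid_tournament m N))" by (rule finite_subset) simp
  then have "pair_fin_digraph (grid_tournament m N)"
    by unfold_locales (auto simp: grid_tournament_def)
  then show ?thesis
    unfolding tournament_iff
  proof (intro conjI allI impI ballI)
    fix u v assume "(u, v) \<in> parcs (grid_tournament m N)"
    then show "(v, u) \<notin> parcs (grid_tournament m N)"
      by (auto simp: grid_tournament_def dominates_def)
  next
    fix u v assume "u \<in> pverts (grid_tournament m N)" "v \<in> pverts (grid_tournament m N)" "u \<noteq> v"
    then show "(u, v) \<in> parcs (grid_tournament m N) \<or> (v, u) \<in> parcs (grid_tournament m N)"
      using dominates_total[of "\<lambda>x. x div m" u v "\<lambda>x. x mod m"] eq[of u v]
      by (auto simp: grid_tournament_def)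
  qed
qed

lemma max_acyclic_chromatic_grid_le_card: "max_acyclic_chromatic (grid_tournament m N) \<le> N"
proof (rule max_acyclic_chromatic_leI)
  show "pair_fin_digraph (grid_tournament m N)"
    using tournament_grid_tournament tournament_iff by blast
  fix H assume "subgraph (with_proj H) (with_proj (grid_tournament m N))"
  then show "oriented_chromatic_number H \<le> N"
    by (intro oriented_chromatic_number_le[of id])
      (fastforce simp: subgraph_with_proj_iff grid_tournament_def dominates_def)+
qed

text \<open>With \<open>M = 2 * m\<close> and \<open>m\<^sup>2\<close> vertices the greedy bound
  reads \<open>8 * k ^ 3 \<le> 54 * m ^ 5\<close>, and the hypothesis makes the right side at most
  \<open>8 * n ^ 3\<close>.\<close>

lemma max_acyclic_chromatic_grid_square_le:
  assumes "m > 0" and "27 * m ^ 5 \<le> 4 * n ^ 3"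
  shows "max_acyclic_chromatic (grid_tournament m (m\<^sup>2)) \<le> n"
proof (rule max_acyclic_chromatic_leI)
  let ?r = "\<lambda>x. x div m" and ?c = "\<lambda>x. x mod m"
  let ?V = "{..<m\<^sup>2}"
  show "pair_fin_digraph (grid_tournament m (m\<^sup>2))"
    using tournament_grid_tournament tournament_iff by blast
  fix H assume sub: "subgraph (with_proj H) (with_proj (grid_tournament m (m\<^sup>2)))"
    and "acyclic_digraph H"
  have H: "pverts H \<subseteq> ?V" "parcs H \<subseteq> {(u, v). u < m\<^sup>2 \<and> v < m\<^sup>2 \<and> dominates ?r ?c u v}"
    "pair_wf_digraph H"
    using sub by (auto simp: subgraph_with_proj_iff grid_tournament_def)
  have "finite (pverts H)" using H(1) by (rule finite_subset) simp
  then obtain \<pi> :: "nat \<Rightarrow> nat" where \<pi>: "\<And>u v. (u, v) \<in> parcs H \<Longrightarrow> \<pi> u < \<pi> v"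
    using acyclic_digraph_potential[OF H(3) _ \<open>acyclic_digraph H\<close>] by blast
  have large: "\<exists>S\<subseteq>W. Suc l \<le> card S \<and> backward_set (dominates ?r ?c) \<pi> S"
    if W: "W \<subseteq> ?V" "2 * m * l ^ 3 < card W" for W l
  proof (rule large_backward_set[OF _ _ _ _ W(2)])
    show "finite W" using W(1) by (rule finite_subset) simp
    show "?r ` W \<subseteq> {..<m}"
      using W(1) by (auto simp: power2_eq_square less_mult_imp_div_less)
    show "?c ` W \<subseteq> {..<m}" using \<open>m > 0\<close> by auto
    show "inj_on (\<lambda>v. (?r v, ?c v)) W" by (rule inj_onI) (metis div_mult_mod_eq prod.inject)
  qed
  obtain p k where p: "p ` ?V \<subseteq> {..<k}"
    "\<And>i. i < k \<Longrightarrow> backward_set (dominates ?r ?c) \<pi> {v \<in> ?V. p v = i}"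
    "8 * k ^ 3 \<le> 27 * (2 * m) * (card ?V)\<^sup>2"
    using greedy_partition[of ?V "2 * m", OF _ _ large] \<open>m > 0\<close> by auto
  have "oriented_chromatic_number H \<le> k"
  proof (rule oriented_chromatic_number_le)
    show "p ` pverts H \<subseteq> {..<k}" using p(1) H(1) by blast
    fix u v assume uv: "(u, v) \<in> parcs H"
    show "p u \<noteq> p v"
    proof
      assume "p u = p v"
      moreover have "u \<in> ?V" "v \<in> ?V" "dominates ?r ?c u v" using uv H(2) by auto
      moreover have "p u < k" using p(1) \<open>u \<in> ?V\<close> by blast
      ultimately have "\<pi> v \<le> \<pi> u" using p(2)[of "p u"] by (auto simp: backward_set_def)
      then show False using \<pi>[OF uv] by simp
    qed
  qed
  moreover have "k \<le> n"
  proof -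
    have "m ^ 5 = m * (m\<^sup>2)\<^sup>2" by (simp add: eval_nat_numeral)
    then have "8 * k ^ 3 \<le> 2 * (27 * m ^ 5)" using p(3) by simp
    also have "\<dots> \<le> 8 * n ^ 3" using assms(2) by simp
    finally show ?thesis by (simp add: power_mono_iff)
  qed
  ultimately show "oriented_chromatic_number H \<le> n" by simp
qed

section \<open>Choice of the grid size\<close>

theorem theorem1p6:
  fixes n :: nat
  assumes "n > 0"
  shows "(\<exists>G :: nat pair_pre_digraph. tournament G \<and>
            real (card (pverts G)) > real n powr (8 / 7) / 4 \<and> max_acyclic_chromatic G \<le> n)
         \<and> real (tournament_threshold n) \<ge> real n powr (8 / 7) / 4"
proof -
  have "\<exists>G :: nat pair_pre_digraph. tournament G \<and>
    real (card (pverts G)) > real n powr (8 / 7) / 4 \<and> max_acyclic_chromatic G \<le> n"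
  \<comment> \<open>The cut-off is where \<open>n powr (8 / 7) / 4\<close> reaches
    \<open>n\<close>.\<close>
  proof (cases "n < 4 ^ 7")
    case True
    \<comment> \<open>Here \<open>n\<close> vertices already suffice.\<close>
    have "real n < real (4 ^ 7)" using True by (simp only: of_nat_less_iff)
    then have "real n < 4 powr 7" by simp
    then have "real n powr (1 / 7) < (4 powr 7) powr (1 / 7)" by (intro powr_less_mono2) simp_all
    also have "(4 powr 7) powr (1 / 7) = (4 :: real)" by (subst powr_powr) simp
    finally have "real n * real n powr (1 / 7) < real n * 4" using assms by simp
    moreover have "real n powr (8 / 7) = real n * real n powr (1 / 7)"
      using assms powr_add[of "real n" 1 "1 / 7"] by simp
    ultimately have "real n powr (8 / 7) / 4 < real n" by simp
    moreover have "card (pverts (grid_tournament 1 n)) = n" by (simp add: grid_tournament_def)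
    ultimately show ?thesis
      using tournament_grid_tournament max_acyclic_chromatic_grid_le_card
      by (intro exI[of _ "grid_tournament 1 n"]) simp
  next
    case False
    \<comment> \<open>Since \<open>y\<^sup>2 = n powr (8 / 7)\<close>, a side \<open>m\<close>
      strictly above \<open>y / 2\<close> gives enough vertices; the \<open>+ 1\<close> after the
      floor makes it strict.\<close>
    define y where "y = real n powr (4 / 7)"
    define m where "m = nat \<lfloor>y / 2\<rfloor> + 1"
    have "real (4 ^ 7) \<le> real n" using False by (simp only: of_nat_le_iff not_less)
    then have "4 powr 7 \<le> real n" by simp
    then have "(4 powr 7) powr (4 / 7) \<le> y" unfolding y_def by (intro powr_mono2) simp_all
    moreover have "(4 powr 7) powr (4 / 7) = (4 powr 4 :: real)" by (subst powr_powr) simp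
    ultimately have y: "256 \<le> y" by simp
    have "real (nat \<lfloor>y / 2\<rfloor>) = of_int \<lfloor>y / 2\<rfloor>" using y by simp
    then have m: "real m \<le> y / 2 + 1" "y / 2 < real m" by (simp_all add: m_def) linarith+
    have sq: "y\<^sup>2 = real n powr (8 / 7)"
      using assms by (simp add: y_def power2_eq_square flip: powr_add)
    have y5: "y ^ 5 \<le> real n ^ 3"
    proof -
      have "y ^ 5 = real n powr (20 / 7)"
        using assms by (simp add: y_def powr_power)
      \<comment> \<open>The exponent slack: 20/7 is below 3.\<close>
      also have "\<dots> \<le> real n powr 3" using assms by (intro powr_mono) simp_all
      finally show ?thesis using assms by simp
    qed
    \<comment> \<open>As \<open>y\<close> is at least 256, the summand 1 is at most
      \<open>y / 16\<close>. The factor \<open>27 * (9 / 16) ^ 5\<close> is about 1.5, below the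
      allowed 4.\<close>
    have "real m \<le> 9 / 16 * y" using m(1) y by simp
    then have "real m ^ 5 \<le> (9 / 16 * y) ^ 5" by (rule power_mono) simp
    then have "27 * real m ^ 5 \<le> 27 * (9 / 16) ^ 5 * y ^ 5" by (simp add: power_mult_distrib power_divide)
    also have "\<dots> \<le> 4 * y ^ 5" using y by (intro mult_right_mono) (simp_all add: field_simps)
    also have "\<dots> \<le> 4 * real n ^ 3" using y5 by simp
    finally have "real (27 * m ^ 5) \<le> real (4 * n ^ 3)" by simp
    then have "27 * m ^ 5 \<le> 4 * n ^ 3" by (simp only: of_nat_le_iff)
    then have "max_acyclic_chromatic (grid_tournament m (m\<^sup>2)) \<le> n"
      by (intro max_acyclic_chromatic_grid_square_le) (simp_all add: m_def)
    moreover have "(y / 2)\<^sup>2 < (real m)\<^sup>2" using m(2) y by (intro power_strict_mono) simp_all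
    then have "real n powr (8 / 7) / 4 < real (card (pverts (grid_tournament m (m\<^sup>2))))"
      by (simp add: grid_tournament_def sq power_divide)
    ultimately show ?thesis using tournament_grid_tournament by blast
  qed
  then show ?thesis using card_le_tournament_threshold by force
qed

end
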